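(* Let $G$ be a graph on $n$ vertices (with $n \geq 1$). Then $\operatorname{diam}(\mathcal{I}(G)) \leq n-1$.
   Context: Graphs are finite and simple (no loops, no multiple edges). An orientation of a graph $G$ is obtained by choosing one of the two directions for each edge of $G$. In an orientation $\vec{G}$ of $G$, the inversion of a set $X \subseteq V(G)$ consists in reversing all arcs with both endvertices in $X$. The (labelled) inversion graph $\mathcal{I}(G)$ is the graph whose vertices are the labelled orientations of $G$ (i.e. orientations of $G$ with vertices labelled, isomorphic orientations not being identified), two orientations being adjacent if and only if there is a set $X\subseteq V(G)$ whose inversion transforms one into the other. The inversion diameter of $G$ is the diameter $\operatorname{diam}(\mathcal{I}(G))$ of this graph, i.e. the least $k$ such that any orientation of $G$ can be transformed into any other one by at most $k$ inversions. *)

theory Defs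
  imports "Graph_Theory.Shortest_Path" "Graph_Theory.Pair_Digraph"
begin

text \<open>
  A finite simple graph is a \<^const>\<open>pair_graph\<close>: an undirected edge \<open>uv\<close> is encoded by the two
  opposite arcs \<open>(u,v)\<close> and \<open>(v,u)\<close>.
\<close>

text \<open>
  The vertex type carries the labels: two orientations are identified only if they have the
  same arc set.
\<close>

definition orientations :: "'a pair_pre_digraph \<Rightarrow> 'a pair_pre_digraph set" where
  "orientations G =
     {D. pverts D = pverts G \<and> parcs D \<subseteq> parcs G \<and>
         (\<forall>(u,v) \<in> parcs G. (u,v) \<in> parcs D \<longleftrightarrow> (v,u) \<notin> parcs D)}"

definition inversion :: "'a set \<Rightarrow> 'a pair_pre_digraph \<Rightarrow> 'a pair_pre_digraph" where
  "inversion X D =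
     D\<lparr>parcs := {(u,v) \<in> parcs D. \<not> (u \<in> X \<and> v \<in> X)}
              \<union> {(v,u) | u v. (u,v) \<in> parcs D \<and> u \<in> X \<and> v \<in> X}\<rparr>"

text \<open>
  The inversion graph is kept simple: the loops coming from inversions that reverse no arc are
  omitted. Adjacency is symmetric because inverting the same set twice is the identity.
\<close>

definition inversion_graph :: "'a pair_pre_digraph \<Rightarrow> 'a pair_pre_digraph pair_pre_digraph" where
  "inversion_graph G =
     \<lparr>pverts = orientations G,
      parcs = {(D, D'). D \<in> orientations G \<and> D' \<in> orientations G \<and> D \<noteq> D' \<and>
                 (\<exists>X \<subseteq> pverts G. D' = inversion X D)}\<rparr>"

text \<open>
  With unit weights, \<open>wf_digraph.\<mu>\<close> is the usual graph distance (and \<open>\<infinity>\<close> between different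
  components), so the diameter of a disconnected graph is \<open>\<infinity>\<close>.
\<close>

definition graph_diameter :: "('a, 'b) pre_digraph \<Rightarrow> ereal" where
  "graph_diameter H = (SUP (u, v) \<in> verts H \<times> verts H. wf_digraph.\<mu> H (\<lambda>_. 1) u v)"

lemma inversion_inversion:
  "inversion X (inversion X D) = D"
  by (rule pair_pre_digraph.equality) (auto simp: inversion_def)

lemma inversion_in_orientations:
  assumes "pair_graph G" "D \<in> orientations G"
  shows "inversion X D \<in> orientations G"
proof -
  interpret pair_graph G by fact
  have "(v, u) \<in> parcs G" if "(u, v) \<in> parcs G" for u v
    using that arcs_symmetric by blast
  then show ?thesis
    using assms(2) unfolding orientations_def inversion_def by fastforce
qed

text \<open>
  \<open>wf_digraph.\<mu>\<close> has its intended meaning only on well-formed digraphs.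
\<close>

lemma wf_digraph_inversion_graph: "wf_digraph (with_proj (inversion_graph G))"
  by unfold_locales (auto simp: inversion_graph_def)

lemma symmetric_inversion_graph: "symmetric (with_proj (inversion_graph G))"
  unfolding symmetric_def sym_def by (auto simp: inversion_graph_def) (metis inversion_inversion)+

end

theory Submission
  imports Defs
begin

text \<open>
  Order the vertices. For a vertex \<open>v\<close>, inverting \<open>v\<close> together with its neighbours along which
  the two orientations disagree corrects every edge at \<open>v\<close>, and it disturbs only edges between
  other vertices. Treating the vertices one after the other, the last vertex needs no inversion,
  which gives \<open>n - 1\<close> in total.
\<close>

lemma orientations_eqI:
  assumes "D \<in> orientations G" "E \<in> orientations G"
    and "\<And>u v. (u, v) \<in> parcs G \<Longrightarrow> (u, v) \<in> parcs D \<longleftrightarrow> (u, v) \<in> parcs E"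
  shows "D = E"
  using assms unfolding orientations_def
  by (intro pair_pre_digraph.equality) auto

lemma orientations_reverse_arc:
  assumes "D \<in> orientations G" "(u, v) \<in> parcs G"
  shows "(u, v) \<in> parcs D \<longleftrightarrow> (v, u) \<notin> parcs D"
  using assms unfolding orientations_def by blast

lemma arcs_inversion:
  assumes "pair_graph G" "D \<in> orientations G" "(u, v) \<in> parcs G"
  shows "(u, v) \<in> parcs (inversion X D) \<longleftrightarrow>
    (if u \<in> X \<and> v \<in> X then (u, v) \<notin> parcs D else (u, v) \<in> parcs D)"
  using assms(2,3) unfolding orientations_def inversion_def by auto

text \<open>\<open>S\<close> holds the vertices not yet treated: \<open>D\<close> and
  \<open>E\<close> may disagree only on edges inside \<open>S\<close>. Each inversion takes one
  vertex out of \<open>S\<close> and changes \<open>D\<close>, hence the induction on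
  \<open>S\<close> with \<open>D\<close> arbitrary.\<close>

lemma awalk_inversion_graph:
  assumes G: "pair_graph G" and "finite S" "S \<noteq> {}" "S \<subseteq> pverts G"
    and "D \<in> orientations G" and E: "E \<in> orientations G"
    and "\<And>u v. \<lbrakk>(u, v) \<in> parcs G; u \<notin> S \<or> v \<notin> S\<rbrakk> \<Longrightarrow> (u, v) \<in> parcs D \<longleftrightarrow> (u, v) \<in> parcs E"
  shows "\<exists>p. pre_digraph.awalk (with_proj (inversion_graph G)) D p E \<and> length p \<le> card S - 1"
  using assms(2-5,7)
proof (induction S arbitrary: D rule: finite_ne_induct)
  case (singleton x)
  interpret G: pair_graph G by (fact G)
  interpret H: wf_digraph "with_proj (inversion_graph G)" by (rule wf_digraph_inversion_graph)
  \<comment> \<open>Without loops no edge lies inside a singleton, so the last vertex costs no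
    inversion: this is the saved 1 in \<open>card S - 1\<close>.\<close>
  have "D = E"
  proof (rule orientations_eqI)
    show "D \<in> orientations G" "E \<in> orientations G" by fact+
  next
    fix u v assume "(u, v) \<in> parcs G"
    then show "(u, v) \<in> parcs D \<longleftrightarrow> (u, v) \<in> parcs E"
      using singleton.prems(3)[of u v] G.no_loops[of "(u, v)"] by auto
  qed
  moreover have "E \<in> pverts (inversion_graph G)"
    using E by (simp add: inversion_graph_def)
  ultimately have "H.awalk D [] E"
    by (simp add: H.awalk_Nil_iff)
  then show ?case by (intro exI[of _ "[]"]) simp
next
  case (insert x S)
  interpret G: pair_graph G by (fact G)
  interpret H: wf_digraph "with_proj (inversion_graph G)" by (rule wf_digraph_inversion_graph)
  \<comment> \<open>Neighbours of \<open>x\<close> outside \<open>S\<close> already agree, so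
    \<open>X\<close> can stay within \<open>insert x S\<close> and leave the edges at treated
    vertices alone.\<close>
  define X where "X = insert x {y \<in> S. (x, y) \<in> parcs G \<and> ((x, y) \<in> parcs D \<longleftrightarrow> (x, y) \<notin> parcs E)}"
  define D' where "D' = inversion X D"
  have D: "D \<in> orientations G" and D': "D' \<in> orientations G"
    using insert.prems inversion_in_orientations[OF G] by (auto simp: D'_def)
  have agree_x: "(x, y) \<in> parcs D' \<longleftrightarrow> (x, y) \<in> parcs E" if "(x, y) \<in> parcs G" for y
    using that insert.prems(3)[of x y] G.no_loops[of "(x, y)"]
    by (auto simp: D'_def arcs_inversion[OF G D that] X_def)
  have agree: "(u, v) \<in> parcs D' \<longleftrightarrow> (u, v) \<in> parcs E"
    if uv: "(u, v) \<in> parcs G" and "u \<notin> S \<or> v \<notin> S" for u v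
  proof -
    consider "u = x" | "v = x" | "u \<noteq> x" "v \<noteq> x" by blast
    then show ?thesis
    proof cases
      case 1
      then show ?thesis using agree_x uv by simp
    next
      case 2
      \<comment> \<open>\<open>agree_x\<close> covers only arcs written from \<open>x\<close>; an
        orientation contains exactly one of two opposite arcs, so agreement carries over to the
        reverse.\<close>
      have "(v, u) \<in> parcs G" using uv G.arcs_symmetric by blast
      with 2 show ?thesis
        using agree_x[of u] orientations_reverse_arc[OF D' uv] orientations_reverse_arc[OF E uv]
        by simp
    next
      case 3
      then have "u \<notin> insert x S \<or> v \<notin> insert x S" "\<not> (u \<in> X \<and> v \<in> X)"
        using that by (auto simp: X_def)
      then show ?thesis
        using insert.prems(3)[OF uv] by (simp add: D'_def arcs_inversion[OF G D uv])
    qed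
  qed
  obtain p where p: "H.awalk D' p E" "length p \<le> card S - 1"
    using insert.IH[OF _ D' agree] insert.prems(1) by auto
  \<comment> \<open>\<open>card S \<ge> 1\<close> is needed because subtraction truncates: one more
    arc must turn \<open>card S - 1\<close> into \<open>card S\<close>.\<close>
  have card: "card (insert x S) - 1 = card S" "card S \<ge> 1"
    using insert.hyps by (auto simp: Suc_le_eq card_gt_0_iff)
  show ?case
  proof (cases "D = D'")
    \<comment> \<open>The inversion graph has no loops, so an inversion that reverses no arc is
      skipped rather than walked.\<close>
    case True
    then show ?thesis using p card by (intro exI[of _ p]) auto
  next
    case False
    have "X \<subseteq> pverts G" using insert.prems(1) by (auto simp: X_def)
    then have "(D, D') \<in> parcs (inversion_graph G)"
      using False D D' by (auto simp: inversion_graph_def D'_def)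
    moreover have "D \<in> pverts (inversion_graph G)"
      using D by (simp add: inversion_graph_def)
    ultimately have "H.awalk D ((D, D') # p) E"
      using p(1) by (simp add: H.awalk_Cons_iff)
    then show ?thesis using p(2) card by (intro exI[of _ "(D, D') # p"]) auto
  qed
qed

theorem theorem1p1:
  fixes G :: "'a pair_pre_digraph" and n :: nat
  assumes "pair_graph G"
    and "card (pverts G) = n"
    and "n \<ge> 1"
  shows "graph_diameter (with_proj (inversion_graph G)) \<le> ereal (real (n - 1))"
proof -
  interpret G: pair_graph G by fact
  interpret H: wf_digraph "with_proj (inversion_graph G)" by (rule wf_digraph_inversion_graph)
  have "H.\<mu> (\<lambda>_. 1) D E \<le> ereal (real (n - 1))"
    if D: "D \<in> orientations G" and E: "E \<in> orientations G" for D E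
  proof -
    have "finite (pverts G)" "pverts G \<noteq> {}"
      using assms(2,3) by (auto intro: card_ge_0_finite)
    \<comment> \<open>With all vertices untreated, the agreement hypothesis is vacuous, since every
      arc has both ends in \<open>pverts G\<close>.\<close>
    moreover have "u \<in> pverts G \<and> v \<in> pverts G" if "(u, v) \<in> parcs G" for u v
      using that G.in_arcsD1 G.in_arcsD2 by blast
    ultimately obtain p where p: "H.awalk D p E" "length p \<le> n - 1"
      using awalk_inversion_graph[OF assms(1) _ _ order_refl D E] assms(2) by blast
    \<comment> \<open>The distance is an infimum over walks, so any walk bounds it; with unit
      weights its cost is its length.\<close>
    have "H.\<mu> (\<lambda>_. 1) D E \<le> ereal (H.awalk_cost (\<lambda>_. 1) p)"
      by (rule H.min_cost_le_walk_cost[OF p(1)])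
    also have "H.awalk_cost (\<lambda>_. 1) p = real (length p)"
      by (induction p) auto
    also have "ereal (real (length p)) \<le> ereal (real (n - 1))"
      using p(2) by simp
    finally show ?thesis .
  qed
  then show ?thesis
    unfolding graph_diameter_def by (intro SUP_least) (auto simp: inversion_graph_def)
qed

end
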